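(* Let $y>1$ be a real number and let $l$ be an integer such that $l<y<l+1$. Then $$\Gamma(y+1)\le l!\,(l+1)^{y-l}.$$
   Context: $\Gamma$ denotes the Gamma function, $\Gamma(y+1)=\int_0^\infty x^{y}e^{-x}\,dx$. *)

theory Defs
  imports "HOL-Analysis.Analysis"
begin

end

theory Submission
  imports Defs
begin

text \<open>
  The bound is log-convexity of the Gamma function on an interval of length one. The point
  \<open>y + 1\<close> lies between \<open>l + 1\<close> and \<open>l + 2\<close>, so \<open>ln (Gamma (y + 1))\<close> lies below the chord
  between these two integers. By the functional equation the slope of that chord is
  \<open>ln (Gamma (l + 2)) - ln (Gamma (l + 1)) = ln (l + 1)\<close>, and \<open>Gamma (l + 1) = l!\<close>.
  The chord argument works from any positive real base point, which is
  \<open>Gamma_add_le_powr_mult_Gamma\<close>.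
\<close>

text \<open>
  The upper half of Gautschi's inequality: on \<open>[x, x + 1]\<close> the right-hand side is the
  exponential of the chord of \<open>ln \<circ> Gamma\<close>, whose slope \<open>ln x\<close> comes from
  \<open>Gamma (x + 1) = x * Gamma x\<close>.
\<close>

lemma Gamma_add_le_powr_mult_Gamma:
  fixes x t :: real
  assumes "x > 0" "0 \<le> t" "t \<le> 1"
  shows "Gamma (x + t) \<le> x powr t * Gamma x"
proof -
  have "ln (Gamma (x + t)) = (ln \<circ> Gamma) ((1 - t) *\<^sub>R x + t *\<^sub>R (x + 1))"
    by (simp add: algebra_simps)
  also have "\<dots> \<le> (1 - t) * (ln \<circ> Gamma) x + t * (ln \<circ> Gamma) (x + 1)"
    using assms by (intro convex_onD[OF log_convex_Gamma_real]) auto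
  also have "Gamma (x + 1) = x * Gamma x"
    using assms by (intro Gamma_plus1) (auto elim!: nonpos_Ints_cases')
  then have "(1 - t) * (ln \<circ> Gamma) x + t * (ln \<circ> Gamma) (x + 1) = ln (x powr t * Gamma x)"
    using assms by (simp add: ln_mult Gamma_real_pos less_imp_neq[symmetric] algebra_simps ln_powr)
  finally show ?thesis
    using assms by (subst (asm) ln_le_cancel_iff) auto
qed

theorem mainTheorem4:
  fixes y :: real and l :: int
  assumes "y > 1" and "of_int l < y" and "y < of_int l + 1"
  shows "Gamma (y + 1) \<le> fact (nat l) * (of_int l + 1) powr (y - of_int l)"
proof -
  have "l \<ge> 1"
    using assms by linarith
  then have "Gamma (of_int l + 1 :: real) = fact (nat l)"
    using Gamma_of_int[of "l + 1", where 'a = real] by simp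
  moreover have "Gamma ((of_int l + 1) + (y - of_int l))
      \<le> (of_int l + 1) powr (y - of_int l) * Gamma (of_int l + 1)"
    using assms \<open>l \<ge> 1\<close> by (intro Gamma_add_le_powr_mult_Gamma) auto
  ultimately show ?thesis
    by (simp add: algebra_simps)
qed

end
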